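(* Let $d=4^k$ for some integer $k\geq 1$. Then there exists a nonempty finite totally separable packing of translates of the unit ball of $\ell_1^d$ such that each ball in the packing touches at least $2^{\sqrt{d}}$ other balls in the packing.
   Context: $\ell_1^d$ is $\mathbb{R}^d$ with the norm $\|x\|_1=\sum_{i=1}^d|x_i|$. A translative packing of a convex body $K$ in $\mathbb{R}^d$ is a finite collection $\{x_1+K,\dots,x_n+K\}$ of (distinct) translates of $K$ such that no two of them have interior points in common. Two translates in the packing touch if they have a common boundary point. The packing is totally separable if any two touching translates in it have a separating hyperplane that does not intersect the interior of any translate in the packing. *)

theory Defs
  imports "HOL-Analysis.Analysis"
begin

(* The library norm on the type real ^ 'n is the Euclidean one.  All norms on R^d induce the
   same topology, so the library's interior, frontier and compact may be used for l1 balls. *)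
definition l1_norm :: "real ^ 'n \<Rightarrow> real" where
  "l1_norm x = (\<Sum>i\<in>UNIV. \<bar>x $ i\<bar>)"

definition l1_unit_ball :: "(real ^ 'n) set" where
  "l1_unit_ball = {x. l1_norm x \<le> 1}"

definition convex_body :: "'a::euclidean_space set \<Rightarrow> bool" where
  "convex_body K \<longleftrightarrow> convex K \<and> compact K \<and> interior K \<noteq> {}"

(* The packing is the set of the translates themselves, so its members are distinct. *)
definition translative_packing :: "'a::euclidean_space set \<Rightarrow> 'a set set \<Rightarrow> bool" where
  "translative_packing K P \<longleftrightarrow>
     convex_body K \<and> finite P \<and>
     (\<forall>A\<in>P. \<exists>x. A = (+) x ` K) \<and>
     pairwise (\<lambda>A B. interior A \<inter> interior B = {}) P"

definition touches :: "'a::euclidean_space set \<Rightarrow> 'a set \<Rightarrow> bool" where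
  "touches A B \<longleftrightarrow> A \<noteq> B \<and> frontier A \<inter> frontier B \<noteq> {}"

definition separating_hyperplane ::
    "'a::euclidean_space set \<Rightarrow> 'a set \<Rightarrow> 'a set \<Rightarrow> bool" where
  "separating_hyperplane H A B \<longleftrightarrow>
     (\<exists>a b. a \<noteq> 0 \<and> H = {x. a \<bullet> x = b} \<and>
            A \<subseteq> {x. a \<bullet> x \<le> b} \<and> B \<subseteq> {x. a \<bullet> x \<ge> b})"

definition totally_separable :: "'a::euclidean_space set set \<Rightarrow> bool" where
  "totally_separable P \<longleftrightarrow>
     (\<forall>A\<in>P. \<forall>B\<in>P. touches A B \<longrightarrow>
        (\<exists>H. separating_hyperplane H A B \<and> (\<forall>C\<in>P. H \<inter> interior C = {})))"

end

theory Submission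
  imports "HOL-Algebra.Algebraic_Closure_Type" "HOL-Library.Z2"
    "HOL-Combinatorics.Multiset_Permutations" Defs
begin

text \<open>
  The idea is to let parallel hyperplanes \<open>\<Sum>\<^sub>i x\<^sub>i = 2j + 1\<close> do all the separating. Suppose that all
  centres lie in the layers \<open>\<Sum>\<^sub>i x\<^sub>i = 2j\<close> and that two centres in the same layer have
  \<open>\<ell>\<^sub>1\<close>-distance greater than 2. The coordinate sum changes by at most the \<open>\<ell>\<^sub>1\<close>-distance, so two
  balls can touch only if their centres are in consecutive layers, and then the hyperplane halfway
  between these layers separates them and misses every open ball
  (\<open>layered_imp_packing\<close>, \<open>layered_imp_separable\<close>).

  For the centres, read a multiset of size \<open>w\<close> over the coordinates as the nonnegative vector of its
  multiplicities, scaled by \<open>2 / w\<close> to have coordinate sum 2. Given a family \<open>G\<close> of such multisets,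
  take the sums of all subfamilies \<open>S \<subseteq> G\<close>; the sum of \<open>S\<close> is in layer \<open>card S\<close>. Each
  \<open>M \<in> G\<close> can be removed from \<open>S\<close> or added to \<open>S\<close>, which moves the centre by a nonnegative vector
  of norm 2 or its negative. So every ball, including those on the boundary of this finite
  configuration, touches at least \<open>card G\<close> others (\<open>packing_from_separated_family\<close>).

  It remains to find a large \<open>G\<close> in which different sums of equally many members are far apart.
  Label the \<open>d = 4\<^sup>k\<close> coordinates by the elements \<open>\<alpha>\<^sub>i\<close> of the field with \<open>d\<close> elements, and map a
  multiset \<open>M\<close> to the polynomial \<open>\<Prod>\<^bsub>i\<in>M\<^esub> (1 - \<alpha>\<^sub>i X)\<close> modulo \<open>X\<^bsup>h+1\<^esup>\<close>. This map is multiplicative, so on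
  a fibre \<open>G\<close> it takes the same value on all sums of equally many members. If two different
  multisets of the same size have the same value, then after cancelling their common part the two
  polynomials still agree modulo \<open>X\<^bsup>h+1\<^esup>\<close> but are different, so one of them has degree greater than
  \<open>h\<close> and more than \<open>h\<close> elements are left on each side (\<open>root_poly_cong_imp_far\<close>).
  Hence different centres in the same layer are at \<open>\<ell>\<^sub>1\<close>-distance at least \<open>(2h + 2) \<cdot> 2 / w\<close>,
  which is greater than 2 when \<open>w < 2h + 2\<close>. There are at least \<open>d\<^sup>w / w!\<close> multisets and at most
  \<open>d\<^sup>h\<close> values, so some fibre has at least \<open>d\<^bsup>w-h\<^esup> / w!\<close> members (\<open>ex_large_separated_family\<close>). With
  \<open>m = \<surd>d = 2\<^sup>k\<close>, \<open>w = m\<close> and \<open>h = m / 2\<close> this is \<open>m\<^sup>m / m!\<close>, which is at least \<open>2\<^sup>m\<close> once \<open>m \<ge> 6\<close>.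
  For \<open>d = 4\<close> and \<open>d = 16\<close> we have \<open>2\<^sup>m = d\<close>, and \<open>w = 1\<close>, \<open>h = 0\<close> is enough: the centres are then the
  vertices of a cube.
\<close>

section \<open>Finite fields as Frobenius fixed points\<close>

text \<open>
  The polynomial \<open>X\<^sup>q - X\<close> splits over an algebraically closed field, and its derivative is the
  constant \<open>-1\<close> in characteristic dividing \<open>q\<close>, so its \<open>q\<close> roots are distinct. This provides a field
  with \<open>q\<close> elements inside a type, namely the fixed points of a power of the Frobenius map.
\<close>
lemma card_frobenius_fixed_points:
  assumes "prime CHAR('a::alg_closed_field)" and "n \<ge> 1" and "q = CHAR('a) ^ n"
  shows "card {x::'a. x ^ q = x} = q"
proof -
  define p :: "'a poly" where "p = Polynomial.monom 1 q - [:0, 1:]"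
  have "CHAR('a) \<ge> 2"
    using assms(1) by (rule prime_ge_2_nat)
  then have "CHAR('a) ^ n \<ge> CHAR('a)"
    using assms(2) by (intro self_le_power) auto
  with \<open>CHAR('a) \<ge> 2\<close> have "q \<ge> 2"
    using assms(3) by simp
  then have deg: "Polynomial.degree p = q"
    unfolding p_def
    by (subst diff_conv_add_uminus, subst degree_add_eq_left) (auto simp: degree_monom_eq)
  have "p \<noteq> 0"
    using deg \<open>q \<ge> 2\<close> by auto
  have roots: "{x. poly p x = 0} = {x::'a. x ^ q = x}"
    by (auto simp: p_def poly_monom)
  have "of_nat q = (0::'a)"
    using assms(2,3) by (simp add: power_0_left)
  then have "pderiv p = [:- 1:]"
    by (simp add: p_def pderiv_diff pderiv_monom pderiv_pCons)
  have simple: "Polynomial.order x p = 1" if "poly p x = 0" for x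
  proof (rule ccontr)
    assume "Polynomial.order x p \<noteq> 1"
    moreover have "Polynomial.order x p \<noteq> 0"
      using that \<open>p \<noteq> 0\<close> by (simp add: order_root)
    ultimately have "[:- x, 1:] ^ 2 dvd p"
      by (intro dvd_trans[OF le_imp_power_dvd order_1]) auto
    moreover define l where "l = [:- x, 1:]"
    ultimately obtain u where "p = l ^ 2 * u" "poly l x = 0"
      by (auto elim: dvdE)
    then have "poly (pderiv p) x = 0"
      by (simp add: power2_eq_square pderiv_mult)
    then show False
      using \<open>pderiv p = [:- 1:]\<close> by simp
  qed
  obtain A where A: "size A = Polynomial.degree p"
      and p_eq: "p = Polynomial.smult (lead_coeff p) (\<Prod>x\<in>#A. [:-x, 1:])"
    using alg_closed_imp_factorization[OF \<open>p \<noteq> 0\<close>] by blast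
  have "proots p = proots (\<Prod>x\<in>#A. [:-x, 1:])"
    using \<open>p \<noteq> 0\<close> by (subst p_eq) simp
  also have "\<dots> = A"
  proof -
    have "proots (\<Prod>x\<in>#A. f x) = (\<Sum>x\<in>#A. proots (f x))"
      if "\<And>x. f x \<noteq> 0" for f :: "'a \<Rightarrow> 'a poly"
    proof (induction A)
      case (add x A)
      have "(\<Prod>x\<in>#A. f x) \<noteq> 0"
        using that by (auto simp: prod_mset_zero_iff)
      then show ?case
        using add that by (simp add: proots_mult)
    qed simp
    from this[of "\<lambda>x. [:-x, 1:]"] show ?thesis
      by simp
  qed
  finally have "proots p = A" .
  then have "q = size (proots p)"
    using A deg by simp
  also have "\<dots> = (\<Sum>x\<in>{x. poly p x = 0}. Polynomial.order x p)"
    using \<open>p \<noteq> 0\<close> by (simp add: size_multiset_overloaded_eq)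
  also have "\<dots> = card {x. poly p x = 0}"
    using simple by simp
  finally show ?thesis
    using roots by simp
qed

section \<open>The number of multisets of a given size\<close>

lemma finite_multisets_of_size: "finite {M::'n::finite multiset. size M = w}"
proof -
  have "{M::'n multiset. size M = w} \<subseteq> mset ` {xs. set xs \<subseteq> UNIV \<and> length xs = w}"
  proof
    fix M :: "'n multiset" assume "M \<in> {M. size M = w}"
    moreover obtain xs where "mset xs = M" using ex_mset by blast
    ultimately show "M \<in> mset ` {xs. set xs \<subseteq> UNIV \<and> length xs = w}" by auto
  qed
  then show ?thesis
    by (rule finite_subset) (intro finite_imageI finite_lists_length_eq finite)
qed

text \<open>
  A multiset of size \<open>w\<close> is the underlying multiset of at most \<open>w!\<close> of the lists of length \<open>w\<close>.
\<close>
lemma power_le_card_multisets: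
  "CARD('n::finite) ^ w \<le> card {M::'n multiset. size M = w} * fact w"
proof -
  have "CARD('n) ^ w = card {xs::'n list. set xs \<subseteq> UNIV \<and> length xs = w}"
    by (simp only: card_lists_length_eq[OF finite])
  also have "{xs::'n list. set xs \<subseteq> UNIV \<and> length xs = w}
      = (\<Union>M\<in>{M. size M = w}. permutations_of_multiset M)"
    by (auto simp: permutations_of_multiset_def)
  also have "card \<dots> \<le> (\<Sum>M\<in>{M::'n multiset. size M = w}. card (permutations_of_multiset M))"
    by (rule card_UN_le) (rule finite_multisets_of_size)
  also have "\<dots> \<le> (\<Sum>M\<in>{M::'n multiset. size M = w}. fact w)"
    by (rule sum_mono) (auto simp: card_permutations_of_multiset)
  finally show ?thesis
    by simp
qed

section \<open>Multisets with congruent polynomials are far apart\<close>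

text \<open>
  The roots are the inverses of the labels. With constant coefficient 1 the polynomial is
  coprime to \<open>X\<close>, and therefore cancellable modulo powers of \<open>X\<close>. The price is that the label 0
  contributes the factor 1 and leaves no trace in the polynomial.
\<close>
definition root_poly :: "('n \<Rightarrow> 'a::field) \<Rightarrow> 'n multiset \<Rightarrow> 'a poly" where
  "root_poly \<alpha> M = (\<Prod>i\<in>#M. [:1, - \<alpha> i:])"

lemma root_poly_add: "root_poly \<alpha> (M + N) = root_poly \<alpha> M * root_poly \<alpha> N"
  by (simp add: root_poly_def)

lemma root_poly_nonzero: "root_poly \<alpha> M \<noteq> 0"
  by (auto simp: root_poly_def prod_mset_zero_iff)

lemma coeff_0_root_poly: "Polynomial.coeff (root_poly \<alpha> M) 0 = 1"
  by (induction M) (auto simp: root_poly_def coeff_mult)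

lemma degree_root_poly_le: "Polynomial.degree (root_poly \<alpha> M) \<le> size M"
proof (induction M)
  case (add i M)
  have "Polynomial.degree (root_poly \<alpha> (add_mset i M))
      \<le> Polynomial.degree [:1, - \<alpha> i:] + Polynomial.degree (root_poly \<alpha> M)"
    unfolding root_poly_def image_mset_add_mset prod_mset.add_mset by (rule degree_mult_le)
  with add show ?case
    by (auto split: if_splits)
qed (simp add: root_poly_def)

lemma poly_root_poly_eq_0_iff: "poly (root_poly \<alpha> M) x = 0 \<longleftrightarrow> (\<exists>i\<in>#M. \<alpha> i * x = 1)"
  by (induction M) (auto simp: root_poly_def algebra_simps)

text \<open>
  A nonzero label in either multiset gives a common root, which identifies a common element. If there
  is no nonzero label, then both multisets consist of copies of the one element labelled 0, and here
  nonemptiness of both is essential.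
\<close>
lemma root_poly_eq_imp_common_element:
  fixes \<alpha> :: "'n \<Rightarrow> 'a::field"
  assumes "inj \<alpha>" and "M \<noteq> {#}" "N \<noteq> {#}" and eq: "root_poly \<alpha> M = root_poly \<alpha> N"
  shows "\<exists>i. i \<in># M \<and> i \<in># N"
proof (cases "\<exists>i\<in>#M. \<alpha> i \<noteq> 0")
  case True
  then obtain i where i: "i \<in># M" "\<alpha> i \<noteq> 0" by blast
  then have "poly (root_poly \<alpha> N) (inverse (\<alpha> i)) = 0"
    unfolding eq[symmetric] poly_root_poly_eq_0_iff by (intro bexI[of _ i]) auto
  then obtain j where "j \<in># N" "\<alpha> j * inverse (\<alpha> i) = 1"
    by (auto simp: poly_root_poly_eq_0_iff)
  then have "\<alpha> j = \<alpha> i"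
    using i by (simp add: field_simps)
  with \<open>inj \<alpha>\<close> \<open>j \<in># N\<close> i show ?thesis
    by (auto dest: injD)
next
  case zeroM: False
  have zeroN: "\<alpha> j = 0" if "j \<in># N" for j
  proof (rule ccontr)
    assume "\<alpha> j \<noteq> 0"
    with that have "poly (root_poly \<alpha> M) (inverse (\<alpha> j)) = 0"
      unfolding eq poly_root_poly_eq_0_iff by (intro bexI[of _ j]) auto
    with zeroM show False
      by (auto simp: poly_root_poly_eq_0_iff)
  qed
  obtain i j where "i \<in># M" "j \<in># N"
    using assms(2,3) by (meson multiset_nonemptyE)
  with zeroM zeroN have "\<alpha> i = \<alpha> j" by simp
  with \<open>inj \<alpha>\<close> \<open>i \<in># M\<close> \<open>j \<in># N\<close> show ?thesis
    by (auto dest: injD)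
qed

text \<open>
  The polynomial of the common part can be cancelled modulo \<open>X\<^bsup>h+1\<^esup>\<close>. If the two remaining multisets
  had at most \<open>h\<close> elements, their polynomials would have degree at most \<open>h\<close> and so would be equal,
  although the multisets are disjoint.
\<close>
lemma root_poly_cong_imp_far:
  fixes \<alpha> :: "'n \<Rightarrow> 'a::field"
  assumes "inj \<alpha>" and "size M = size N" and "M \<noteq> N"
    and cong: "Polynomial.monom 1 (Suc h) dvd root_poly \<alpha> M - root_poly \<alpha> N"
  shows "size (M - N) > h"
proof (rule ccontr)
  assume "\<not> size (M - N) > h"
  define C where "C = M \<inter># N"
  define M' where "M' = M - N"
  define N' where "N' = N - M"
  have M: "M = C + M'" and N: "N = C + N'"
    by (auto simp: C_def M'_def N'_def multiset_eq_iff)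
  have "size M' = size N'"
    using \<open>size M = size N\<close> M N by simp
  then have small: "size M' \<le> h" "size N' \<le> h"
    using \<open>\<not> size (M - N) > h\<close> by (auto simp: M'_def)
  have "Polynomial.monom 1 (Suc h) dvd root_poly \<alpha> C * (root_poly \<alpha> M' - root_poly \<alpha> N')"
    using cong unfolding M N root_poly_add by (simp add: algebra_simps)
  moreover have "Polynomial.order 0 (root_poly \<alpha> C) = 0"
    using coeff_0_root_poly[of \<alpha> C] by (intro order_0I) (simp add: poly_0_coeff_0)
  ultimately have dvd: "Polynomial.monom 1 (Suc h) dvd root_poly \<alpha> M' - root_poly \<alpha> N'"
    using root_poly_nonzero[of \<alpha> C]
    by (cases "root_poly \<alpha> M' = root_poly \<alpha> N'") (auto simp: monom_1_dvd_iff order_mult)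
  have "Polynomial.degree (root_poly \<alpha> M' - root_poly \<alpha> N') \<le> h"
    using degree_root_poly_le[of \<alpha> M'] degree_root_poly_le[of \<alpha> N'] small
    by (intro degree_diff_le) auto
  then have "root_poly \<alpha> M' = root_poly \<alpha> N'"
    using dvd dvd_imp_degree_le[OF dvd]
    by (cases "root_poly \<alpha> M' = root_poly \<alpha> N'") (auto simp: degree_monom_eq)
  moreover have "M' \<noteq> {#}" "N' \<noteq> {#}"
    using \<open>M \<noteq> N\<close> \<open>size M' = size N'\<close> M N by auto
  ultimately obtain i where "i \<in># M'" "i \<in># N'"
    using root_poly_eq_imp_common_element[OF \<open>inj \<alpha>\<close>] by blast
  then show False
    by (auto simp: M'_def N'_def in_diff_count)
qed

text \<open>
  By multiplicativity, sums of equally many multisets from one fibre lie in a common fibre, whatever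
  the members are.
\<close>
lemma root_poly_sum_cong:
  assumes "finite S" and "\<And>M. M \<in> S \<Longrightarrow> p dvd root_poly \<alpha> M - Q"
  shows "p dvd root_poly \<alpha> (\<Sum>M\<in>S. M) - Q ^ card S"
  using assms
proof (induction S rule: finite_induct)
  case (insert M S)
  have "root_poly \<alpha> (\<Sum>M\<in>insert M S. M) - Q ^ card (insert M S)
      = root_poly \<alpha> M * (root_poly \<alpha> (\<Sum>M\<in>S. M) - Q ^ card S) + (root_poly \<alpha> M - Q) * Q ^ card S"
    using insert.hyps by (simp add: root_poly_add algebra_simps)
  then show ?case
    using insert by (auto intro: dvd_add dvd_mult dvd_mult2)
qed (simp add: root_poly_def)

lemma coeff_root_poly_in_subring:
  assumes "range \<alpha> \<subseteq> F" and "0 \<in> F" "1 \<in> F"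
    and "\<And>x y. x \<in> F \<Longrightarrow> y \<in> F \<Longrightarrow> x - y \<in> F"
    and "\<And>x y. x \<in> F \<Longrightarrow> y \<in> F \<Longrightarrow> x * y \<in> F"
  shows "Polynomial.coeff (root_poly \<alpha> M) j \<in> F"
proof (induction M arbitrary: j)
  case empty
  then show ?case using assms(2,3) by (simp add: root_poly_def)
next
  case (add i M)
  have "root_poly \<alpha> (add_mset i M) = root_poly \<alpha> M - pCons 0 (Polynomial.smult (\<alpha> i) (root_poly \<alpha> M))"
    by (simp add: root_poly_def)
  then have "Polynomial.coeff (root_poly \<alpha> (add_mset i M)) j =
      Polynomial.coeff (root_poly \<alpha> M) j - (case j of 0 \<Rightarrow> 0 | Suc l \<Rightarrow> \<alpha> i * Polynomial.coeff (root_poly \<alpha> M) l)"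
    by (simp add: coeff_pCons split: nat.split)
  also have "\<dots> \<in> F"
    using add assms(1,2,4,5) by (cases j) (auto intro!: assms(4,5))
  finally show ?case .
qed

section \<open>Large families with separated subfamily sums\<close>

text \<open>
  A residue modulo \<open>X\<^bsup>h+1\<^esup>\<close> is given by its coefficients. The constant one is always 1 and
  the other \<open>h\<close> lie in \<open>F\<close>, so the pigeonhole principle applies with \<open>(card F)\<^sup>h\<close> holes.
\<close>
lemma ex_large_fibre:
  fixes \<alpha> :: "'n::finite \<Rightarrow> 'a::field"
  assumes "inj \<alpha>" and F: "finite F" "range \<alpha> \<subseteq> F" "0 \<in> F" "1 \<in> F"
    "\<And>x y. x \<in> F \<Longrightarrow> y \<in> F \<Longrightarrow> x - y \<in> F" "\<And>x y. x \<in> F \<Longrightarrow> y \<in> F \<Longrightarrow> x * y \<in> F"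
  obtains G :: "'n multiset set" where "\<And>M. M \<in> G \<Longrightarrow> size M = w"
    and "card {M::'n multiset. size M = w} \<le> card G * card F ^ h"
    and "\<And>M N. M \<in> G \<Longrightarrow> N \<in> G \<Longrightarrow>
           Polynomial.monom 1 (Suc h) dvd root_poly \<alpha> M - root_poly \<alpha> N"
proof -
  define key where "key M = (\<lambda>j\<in>{1..h}. Polynomial.coeff (root_poly \<alpha> M) j)" for M
  define keys where "keys = {1..h} \<rightarrow>\<^sub>E F"
  have "key \<in> {M. size M = w} \<rightarrow> keys"
    using coeff_root_poly_in_subring[OF F(2-6)] by (auto simp: key_def keys_def)
  moreover have "finite keys" "keys \<noteq> {}"
    using F by (auto simp: keys_def finite_PiE PiE_eq_empty_iff)
  ultimately obtain y where
    y: "card {M::'n multiset. size M = w} \<le> card (key -` {y} \<inter> {M. size M = w}) * card keys"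
    using pigeonhole_card[OF _ finite_multisets_of_size] by blast
  have "card keys = card F ^ h"
    by (simp add: keys_def card_PiE)
  have cong: "Polynomial.monom 1 (Suc h) dvd root_poly \<alpha> M - root_poly \<alpha> N"
    if "key M = key N" for M N
    unfolding monom_1_dvd_iff'
  proof (intro allI impI)
    fix j assume "j < Suc h"
    show "Polynomial.coeff (root_poly \<alpha> M - root_poly \<alpha> N) j = 0"
    proof (cases "j = 0")
      case False
      with \<open>j < Suc h\<close> show ?thesis
        using fun_cong[OF that, of j] by (simp add: key_def)
    qed (simp add: coeff_0_root_poly)
  qed
  show thesis
    using y \<open>card keys = card F ^ h\<close> cong
    by (intro that[of "key -` {y} \<inter> {M. size M = w}"]) auto
qed

text \<open>
  Taking for \<open>F\<close> a field with exactly as many elements as there are coordinates wastes nothing in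
  the pigeonhole count. Such a field exists because this number is a power of 2: \<open>F\<close> consists of Frobenius fixed
  points in the algebraic closure of the field with two elements.
\<close>
lemma ex_large_separated_family:
  assumes "r \<ge> 1" and "CARD('n::finite) = 2 ^ r"
  obtains G :: "'n::finite multiset set" where "\<And>M. M \<in> G \<Longrightarrow> size M = w"
    and "CARD('n::finite) ^ w \<le> card G * fact w * CARD('n) ^ h"
    and "\<And>S T. S \<subseteq> G \<Longrightarrow> T \<subseteq> G \<Longrightarrow> card S = card T \<Longrightarrow> \<Sum>S \<noteq> \<Sum>T \<Longrightarrow> size (\<Sum>S - \<Sum>T) > h"
proof -
  let ?q = "CARD('n)"
  define F where "F = {x :: bit alg_closure. x ^ ?q = x}"
  have char: "CHAR(bit alg_closure) = 2"
  proof -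
    have "(of_nat n :: bit) = of_bool (odd n)" for n
      by (induction n) auto
    then have "CHAR(bit) = 2"
      by (intro CHAR_eqI) auto
    then show ?thesis by simp
  qed
  have "card F = ?q"
    unfolding F_def by (rule card_frobenius_fixed_points) (use assms char in auto)
  then have "finite F"
    by (metis card.infinite finite_UNIV_card_ge_0 finite less_irrefl)
  obtain \<alpha> :: "'n \<Rightarrow> bit alg_closure" where \<alpha>: "bij_betw \<alpha> UNIV F"
    using \<open>card F = ?q\<close> \<open>finite F\<close> by (metis finite finite_same_card_bij)
  then have "inj \<alpha>" "range \<alpha> \<subseteq> F"
    by (auto simp: bij_betw_def)
  have add: "x + y \<in> F" if "x \<in> F" "y \<in> F" for x y
    using that freshmans_dream'[of ?q r x y] char assms by (simp add: F_def)
  have "- x = x" for x :: "bit alg_closure"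
  proof -
    have "x + x = of_nat 2 * x" by simp
    also have "\<dots> = 0" using char by (metis mult_zero_left of_nat_CHAR)
    finally show ?thesis by (simp add: add_eq_0_iff)
  qed
  then have diff: "x - y \<in> F" if "x \<in> F" "y \<in> F" for x y
    using add[OF that] by (metis diff_conv_add_uminus)
  have mult: "x * y \<in> F" if "x \<in> F" "y \<in> F" for x y
    using that by (simp add: F_def power_mult_distrib)
  have "0 \<in> F" "1 \<in> F"
    by (auto simp: F_def power_0_left)
  obtain G :: "'n multiset set" where size: "\<And>M. M \<in> G \<Longrightarrow> size M = w"
    and large: "card {M::'n multiset. size M = w} \<le> card G * card F ^ h"
    and cong: "\<And>M N. M \<in> G \<Longrightarrow> N \<in> G \<Longrightarrow>
           Polynomial.monom 1 (Suc h) dvd root_poly \<alpha> M - root_poly \<alpha> N"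
    using ex_large_fibre[OF \<open>inj \<alpha>\<close> \<open>finite F\<close> \<open>range \<alpha> \<subseteq> F\<close> \<open>0 \<in> F\<close> \<open>1 \<in> F\<close> diff mult, of w h]
    by blast
  show thesis
  proof (rule that[of G])
    have "?q ^ w \<le> card {M::'n multiset. size M = w} * fact w"
      by (rule power_le_card_multisets)
    also have "\<dots> \<le> (card G * card F ^ h) * fact w"
      using large by (rule mult_right_mono) simp
    finally show "?q ^ w \<le> card G * fact w * ?q ^ h"
      using \<open>card F = ?q\<close> by (simp add: mult_ac)
  next
    fix S T assume ST: "S \<subseteq> G" "T \<subseteq> G" "card S = card T" "\<Sum>S \<noteq> \<Sum>T"
    have fin: "finite S" "finite T"
      using ST size finite_multisets_of_size[of w, where 'n='n] by (auto intro!: finite_subset[of _ "{M. size M = w}"])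
    have sz: "size (\<Sum>U) = w * card U" if "U \<subseteq> G" "finite U" for U
      using that(2,1) by (induction U rule: finite_induct) (auto simp: size)
    obtain M where M: "M \<in> G"
      using ST fin by (cases "S = {}") auto
    have "Polynomial.monom 1 (Suc h) dvd root_poly \<alpha> (\<Sum>U) - root_poly \<alpha> M ^ card U"
      if "U \<subseteq> G" "finite U" for U
      using that M cong by (intro root_poly_sum_cong) auto
    from this[of S] this[of T] have
      "Polynomial.monom 1 (Suc h) dvd root_poly \<alpha> (\<Sum>S) - root_poly \<alpha> (\<Sum>T)"
      using ST fin dvd_diff[of "Polynomial.monom 1 (Suc h)"
          "root_poly \<alpha> (\<Sum>S) - root_poly \<alpha> M ^ card S"
          "root_poly \<alpha> (\<Sum>T) - root_poly \<alpha> M ^ card T"]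
      by simp
    then show "size (\<Sum>S - \<Sum>T) > h"
      using ST fin sz \<open>inj \<alpha>\<close> by (intro root_poly_cong_imp_far) auto
  qed (use size in auto)
qed

text \<open>
  In the step from \<open>m\<close> to \<open>m + 1\<close> the quotient of the two sides grows by the factor
  \<open>(1 + 1/m)\<^sup>m / 2\<close>, which is at least 1 by the Bernoulli inequality; 6 is the first positive
  \<open>m\<close> at which the inequality holds.
\<close>
lemma two_power_fact_le_self_power: "6 \<le> m \<Longrightarrow> 2 ^ m * fact m \<le> (m ^ m :: nat)"
proof (induction m rule: dec_induct)
  case base
  show ?case by (simp add: fact_numeral)
next
  case (step m)
  have "2 * m ^ m \<le> (m + 1) ^ m"
  proof -
    have "real (2 * m ^ m) = real m ^ m * (1 + real m * (1 / real m))"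
      using step by simp
    also have "\<dots> \<le> real m ^ m * (1 + 1 / real m) ^ m"
      by (intro mult_left_mono Bernoulli_inequality) (auto intro: order_trans[of _ 0])
    also have "\<dots> = real ((m + 1) ^ m)"
      using step by (simp add: field_simps flip: power_mult_distrib)
    finally show ?thesis by linarith
  qed
  moreover have "2 ^ Suc m * fact (Suc m) = 2 * (m + 1) * (2 ^ m * fact m)"
    by (simp add: algebra_simps)
  moreover have "\<dots> \<le> 2 * (m + 1) * m ^ m"
    using step by (intro mult_left_mono) auto
  ultimately have "2 ^ Suc m * fact (Suc m) \<le> (m + 1) * (m + 1) ^ m"
    by (metis (no_types, lifting) mult.assoc mult.left_commute mult_le_mono2 order_trans)
  then show ?case by simp
qed

section \<open>The geometry of \<open>\<ell>\<^sub>1\<close> balls\<close>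

lemma l1_norm_triangle: "l1_norm (x + y) \<le> l1_norm x + l1_norm y"
  by (simp add: l1_norm_def sum_mono flip: sum.distrib)

lemma l1_norm_scaleR: "l1_norm (c *\<^sub>R x) = \<bar>c\<bar> * l1_norm x"
  by (simp add: l1_norm_def abs_mult sum_distrib_left)

lemma l1_norm_minus_commute: "l1_norm (x - y) = l1_norm (y - x)"
  by (simp add: l1_norm_def abs_minus_commute)

lemma norm_le_l1_norm: "norm x \<le> l1_norm x"
  by (simp add: l1_norm_def norm_le_l1_cart)

lemma continuous_on_l1_norm: "continuous_on S l1_norm"
  unfolding l1_norm_def by (intro continuous_intros)

text \<open>
  The all-ones functional has dual norm 1. This is the inequality behind the separating hyperplanes.
\<close>
lemma abs_sum_le_l1_norm: "\<bar>\<Sum>i\<in>UNIV. x $ i\<bar> \<le> l1_norm x"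
  by (simp add: l1_norm_def)

lemma compact_l1_unit_ball: "compact (l1_unit_ball :: (real^'n) set)"
proof -
  have "closed (l1_unit_ball :: (real^'n) set)"
    unfolding l1_unit_ball_def
    by (intro closed_Collect_le continuous_on_l1_norm continuous_on_const)
  moreover have "bounded (l1_unit_ball :: (real^'n) set)"
    unfolding bounded_iff l1_unit_ball_def using norm_le_l1_norm order_trans by blast
  ultimately show ?thesis
    by (simp add: compact_eq_bounded_closed)
qed

lemma convex_l1_unit_ball: "convex l1_unit_ball"
proof (rule convexI)
  fix x y :: "real^'n" and u v :: real
  assume xy: "x \<in> l1_unit_ball" "y \<in> l1_unit_ball" and uv: "0 \<le> u" "0 \<le> v" "u + v = 1"
  have "l1_norm (u *\<^sub>R x + v *\<^sub>R y) \<le> u * l1_norm x + v * l1_norm y"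
    using l1_norm_triangle[of "u *\<^sub>R x" "v *\<^sub>R y"] uv by (simp add: l1_norm_scaleR)
  also have "\<dots> \<le> 1"
    using xy uv by (intro convex_bound_le) (auto simp: l1_unit_ball_def)
  finally show "u *\<^sub>R x + v *\<^sub>R y \<in> l1_unit_ball"
    by (simp add: l1_unit_ball_def)
qed

lemma interior_l1_unit_ball: "interior l1_unit_ball = {x. l1_norm x < 1}"
proof
  show "{x. l1_norm x < 1} \<subseteq> interior l1_unit_ball"
    by (rule interior_maximal)
      (auto simp: l1_unit_ball_def intro!: open_Collect_less continuous_on_l1_norm)
next
  show "interior l1_unit_ball \<subseteq> {x::real^'n. l1_norm x < 1}"
  proof (rule ccontr)
    assume "\<not> interior l1_unit_ball \<subseteq> {x::real^'n. l1_norm x < 1}"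
    then obtain x :: "real^'n" where x: "x \<in> interior l1_unit_ball" "l1_norm x \<ge> 1"
      using not_less by blast
    then obtain e where e: "e > 0" "cball x e \<subseteq> l1_unit_ball"
      by (meson mem_interior_cball)
    have "norm x > 0"
      using x by (auto simp: l1_norm_def)
    \<comment> \<open>Moving a boundary point outwards by \<open>e\<close> keeps it in the ball but increases its norm.\<close>
    have "dist x ((1 + e / norm x) *\<^sub>R x) \<le> e"
      using \<open>norm x > 0\<close> e by (simp add: dist_norm algebra_simps)
    then have "l1_norm ((1 + e / norm x) *\<^sub>R x) \<le> 1"
      using e by (auto simp: l1_unit_ball_def)
    moreover have "1 * 1 < (1 + e / norm x) * l1_norm x"
      using x e \<open>norm x > 0\<close> by (intro mult_less_le_imp_less) auto
    ultimately show False
      using e \<open>norm x > 0\<close> by (simp add: l1_norm_scaleR)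
  qed
qed

lemma frontier_l1_unit_ball: "frontier l1_unit_ball = {x. l1_norm x = 1}"
  unfolding frontier_def interior_l1_unit_ball
    closure_closed[OF compact_imp_closed[OF compact_l1_unit_ball]]
  by (auto simp: l1_unit_ball_def)

lemma convex_body_l1_unit_ball: "convex_body l1_unit_ball"
proof -
  have "0 \<in> interior l1_unit_ball"
    by (simp add: interior_l1_unit_ball l1_norm_def)
  then show ?thesis
    using compact_l1_unit_ball convex_l1_unit_ball by (auto simp: convex_body_def)
qed

abbreviation l1_ball :: "real^'n \<Rightarrow> (real^'n) set" where
  "l1_ball x \<equiv> (+) x ` l1_unit_ball"

lemma in_translate_iff: "p \<in> (+) x ` S \<longleftrightarrow> p - x \<in> (S :: 'a::ab_group_add set)"
  by (auto simp: image_iff algebra_simps intro!: bexI[of _ "p - x"])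

lemma mem_l1_ball: "p \<in> l1_ball x \<longleftrightarrow> l1_norm (p - x) \<le> 1"
  by (simp add: in_translate_iff l1_unit_ball_def)

lemma mem_interior_l1_ball: "p \<in> interior (l1_ball x) \<longleftrightarrow> l1_norm (p - x) < 1"
  by (simp add: interior_translation in_translate_iff interior_l1_unit_ball)

lemma mem_frontier_l1_ball: "p \<in> frontier (l1_ball x) \<longleftrightarrow> l1_norm (p - x) = 1"
  by (simp add: frontier_translation in_translate_iff frontier_l1_unit_ball)

lemma disjoint_interior_l1_balls:
  assumes "l1_norm (x - y) \<ge> 2"
  shows "interior (l1_ball x) \<inter> interior (l1_ball y) = {}"
proof (rule equals0I)
  fix p assume "p \<in> interior (l1_ball x) \<inter> interior (l1_ball y)"
  then have "l1_norm (x - p) < 1" "l1_norm (p - y) < 1"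
    by (auto simp: mem_interior_l1_ball l1_norm_minus_commute)
  then show False
    using assms l1_norm_triangle[of "x - p" "p - y"] by simp
qed

lemma l1_ball_inj:
  assumes "l1_ball x = l1_ball y"
  shows "x = y"
proof (rule ccontr)
  assume "x \<noteq> y"
  \<comment> \<open>With this scaling, \<open>x + c (x - y)\<close> is a point of the first ball farthest from \<open>y\<close>.\<close>
  define c where "c = 1 / l1_norm (x - y)"
  have pos: "l1_norm (x - y) > 0"
    using norm_le_l1_norm[of "x - y"] \<open>x \<noteq> y\<close> by (smt (verit) zero_less_norm_iff right_minus_eq)
  have "l1_norm ((x + c *\<^sub>R (x - y)) - x) = 1"
    using pos by (simp add: l1_norm_scaleR c_def)
  then have "l1_norm ((x + c *\<^sub>R (x - y)) - y) \<le> 1"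
    using assms by (metis mem_l1_ball order_refl)
  moreover have "(x + c *\<^sub>R (x - y)) - y = (1 + c) *\<^sub>R (x - y)"
    by (simp add: algebra_simps)
  ultimately have "(1 + c) * l1_norm (x - y) \<le> 1"
    using pos by (simp add: l1_norm_scaleR c_def)
  moreover have "(1 + c) * l1_norm (x - y) = l1_norm (x - y) + 1"
    using pos by (simp add: c_def field_simps)
  ultimately show False
    using pos by simp
qed

lemma touches_imp_l1_dist_le:
  assumes "touches (l1_ball x) (l1_ball y)"
  shows "l1_norm (x - y) \<le> 2"
proof -
  obtain p where "l1_norm (p - x) = 1" "l1_norm (p - y) = 1"
    using assms by (auto simp: touches_def mem_frontier_l1_ball)
  then show ?thesis
    using l1_norm_triangle[of "x - p" "p - y"] by (simp add: l1_norm_minus_commute[of x p])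
qed

lemma touches_if_l1_dist_eq:
  assumes "l1_norm (x - y) = 2"
  shows "touches (l1_ball x) (l1_ball y)"
proof -
  \<comment> \<open>The midpoint of the centres is a common boundary point.\<close>
  define p where "p = (1/2) *\<^sub>R (x + y)"
  have "p - x = (1/2) *\<^sub>R (y - x)" "p - y = (1/2) *\<^sub>R (x - y)"
    by (auto simp: p_def vec_eq_iff field_simps)
  then have "p \<in> frontier (l1_ball x) \<inter> frontier (l1_ball y)"
    using assms by (simp add: mem_frontier_l1_ball l1_norm_scaleR l1_norm_minus_commute[of y x])
  moreover have "x \<noteq> y"
    using assms by (auto simp: l1_norm_def)
  ultimately show ?thesis
    unfolding touches_def using l1_ball_inj by blast
qed

section \<open>Layered sets of centres\<close>

text \<open>
  The function \<open>f\<close> numbers the layers. Centres in one layer are required to be at distance strictly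
  greater than 2: touching balls within a layer could not be separated by a hyperplane between layers.
\<close>
definition layered :: "(real^'n) set \<Rightarrow> (real^'n \<Rightarrow> nat) \<Rightarrow> bool" where
  "layered Z f \<longleftrightarrow> (\<forall>x\<in>Z. (\<Sum>i\<in>UNIV. x $ i) = 2 * real (f x)) \<and>
     (\<forall>x\<in>Z. \<forall>y\<in>Z. x \<noteq> y \<longrightarrow> f x = f y \<longrightarrow> l1_norm (x - y) > 2)"

lemma coordinate_sum_diff_le: "(\<Sum>i\<in>UNIV. x $ i) - (\<Sum>i\<in>UNIV. y $ i) \<le> l1_norm (x - y)"
  using abs_sum_le_l1_norm[of "x - y"] by (simp add: sum_subtractf)

lemma layered_imp_l1_dist_ge:
  assumes "layered Z f" "x \<in> Z" "y \<in> Z" "x \<noteq> y"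
  shows "l1_norm (x - y) \<ge> 2"
proof (cases "f x = f y")
  case False
  then have "\<bar>2 * real (f x) - 2 * real (f y)\<bar> \<ge> 2"
    by linarith
  moreover have "\<bar>2 * real (f x) - 2 * real (f y)\<bar> \<le> l1_norm (x - y)"
    using assms coordinate_sum_diff_le[of x y] coordinate_sum_diff_le[of y x]
    by (auto simp: layered_def l1_norm_minus_commute[of y x])
  ultimately show ?thesis by simp
qed (use assms in \<open>force simp: layered_def\<close>)

lemma layered_imp_packing:
  assumes "layered Z f" "finite Z"
  shows "translative_packing l1_unit_ball (l1_ball ` Z)"
proof -
  have "pairwise (\<lambda>A B. interior A \<inter> interior B = {}) (l1_ball ` Z)"
    unfolding pairwise_def
    using layered_imp_l1_dist_ge[OF assms(1)] disjoint_interior_l1_balls by blast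
  then show ?thesis
    using assms(2) convex_body_l1_unit_ball by (auto simp: translative_packing_def)
qed

lemma inner_one_vec: "(\<chi> i. 1) \<bullet> x = (\<Sum>i\<in>UNIV. x $ i)" for x :: "real^'n"
  by (simp add: inner_vec_def)

text \<open>
  Touching balls are in layers \<open>j\<close> and \<open>j + 1\<close>, and the hyperplane \<open>\<Sum>\<^sub>i x\<^sub>i = 2j + 1\<close> separates
  them. Every centre has even coordinate sum, so it is at \<open>\<ell>\<^sub>1\<close>-distance at least 1 from this
  hyperplane.
\<close>
lemma layered_imp_separable:
  assumes "layered Z f"
  shows "totally_separable (l1_ball ` Z)"
proof -
  have sep: "\<exists>H. separating_hyperplane H (l1_ball x) (l1_ball y) \<and>
      separating_hyperplane H (l1_ball y) (l1_ball x) \<and> (\<forall>z\<in>Z. H \<inter> interior (l1_ball z) = {})"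
    if xy: "x \<in> Z" "y \<in> Z" "f x < f y" "l1_norm (x - y) \<le> 2" for x y
  proof -
    let ?s = "\<lambda>x::real^'a. \<Sum>i\<in>UNIV. x $ i"
    let ?one = "\<chi> i. 1 :: real^'a"
    define b where "b = 2 * real (f x) + 1"
    define H :: "(real^'a) set" where "H = {p. ?one \<bullet> p = b}"
    have "?one \<noteq> 0"
      by (simp add: vec_eq_iff)
    have sum: "?s z = 2 * real (f z)" if "z \<in> Z" for z
      using that assms by (simp add: layered_def)
    have "2 * real (f y) - 2 * real (f x) \<le> 2"
      using coordinate_sum_diff_le[of y x] xy sum by (simp add: l1_norm_minus_commute[of y x])
    with xy have "f y = Suc (f x)" by linarith
    have lower: "l1_ball x \<subseteq> {p. ?one \<bullet> p \<le> b}"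
    proof
      fix p assume "p \<in> l1_ball x"
      then show "p \<in> {p. ?one \<bullet> p \<le> b}"
        using coordinate_sum_diff_le[of p x] sum[OF xy(1)]
        by (simp add: inner_one_vec mem_l1_ball b_def)
    qed
    have upper: "l1_ball y \<subseteq> {p. ?one \<bullet> p \<ge> b}"
    proof
      fix p assume "p \<in> l1_ball y"
      then show "p \<in> {p. ?one \<bullet> p \<ge> b}"
        using coordinate_sum_diff_le[of y p] sum[OF xy(2)] \<open>f y = Suc (f x)\<close>
        by (simp add: inner_one_vec mem_l1_ball b_def l1_norm_minus_commute[of y p])
    qed
    have "H \<inter> interior (l1_ball z) = {}" if "z \<in> Z" for z
    proof (rule equals0I)
      fix p assume p: "p \<in> H \<inter> interior (l1_ball z)"
      then have "\<bar>b - ?s z\<bar> < 1"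
        using coordinate_sum_diff_le[of p z] coordinate_sum_diff_le[of z p]
        by (auto simp: H_def inner_one_vec mem_interior_l1_ball l1_norm_minus_commute[of z p])
      then have "\<bar>2 * real (f x) + 1 - 2 * real (f z)\<bar> < 1"
        using sum[OF that] by (simp add: b_def)
      then have "\<bar>2 * int (f x) + 1 - 2 * int (f z)\<bar> < 1"
        by linarith
      then show False by presburger
    qed
    moreover have "separating_hyperplane H (l1_ball x) (l1_ball y)"
      unfolding separating_hyperplane_def using \<open>?one \<noteq> 0\<close> H_def lower upper by blast
    moreover have "separating_hyperplane H (l1_ball y) (l1_ball x)"
    proof -
      have "H = {p. (- ?one) \<bullet> p = - b}"
        by (simp add: H_def)
      moreover have "l1_ball y \<subseteq> {p. (- ?one) \<bullet> p \<le> - b}" "l1_ball x \<subseteq> {p. (- ?one) \<bullet> p \<ge> - b}"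
        using lower upper by auto
      moreover have "- ?one \<noteq> 0"
        using \<open>?one \<noteq> 0\<close> by simp
      ultimately show ?thesis
        unfolding separating_hyperplane_def by blast
    qed
    ultimately show ?thesis by blast
  qed
  show ?thesis
    unfolding totally_separable_def
  proof (intro ballI impI)
    fix A B assume "A \<in> l1_ball ` Z" "B \<in> l1_ball ` Z" "touches A B"
    then obtain x y where xy: "x \<in> Z" "y \<in> Z" "A = l1_ball x" "B = l1_ball y"
      by blast
    have "x \<noteq> y" and le: "l1_norm (x - y) \<le> 2" "l1_norm (y - x) \<le> 2"
      using \<open>touches A B\<close> xy touches_imp_l1_dist_le[of x y]
      by (auto simp: touches_def l1_norm_minus_commute[of y x])
    then have "f x \<noteq> f y"
      using assms xy by (force simp: layered_def)
    then consider "f x < f y" | "f y < f x" by linarith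
    then show "\<exists>H. separating_hyperplane H A B \<and> (\<forall>C\<in>l1_ball ` Z. H \<inter> interior C = {})"
      using sep[of x y] sep[of y x] xy le by cases (simp; blast)+
  qed
qed

section \<open>Packings from multisets\<close>

text \<open>
  The scaling gives multisets of size \<open>w\<close> coordinate sum 2, which is the distance between the centres
  of touching balls and also the distance between layers.
\<close>
definition mset_point :: "nat \<Rightarrow> 'n multiset \<Rightarrow> real^'n" where
  "mset_point w M = (\<chi> i. 2 / real w * real (count M i))"

lemma size_eq_sum_count: "size M = (\<Sum>i\<in>UNIV. count M i)" for M :: "'n::finite multiset"
  unfolding size_multiset_overloaded_eq
  by (rule sum.mono_neutral_left) (auto simp: not_in_iff)

lemma sum_mset_point: "(\<Sum>i\<in>UNIV. mset_point w M $ i) = 2 / real w * real (size M)"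
  by (simp add: mset_point_def size_eq_sum_count sum_distrib_left)

lemma l1_dist_mset_point:
  "l1_norm (mset_point w M - mset_point w N) = 2 / real w * real (size (M - N) + size (N - M))"
proof -
  have "\<bar>real (count M i) - real (count N i)\<bar> = real (count (M - N) i) + real (count (N - M) i)" for i
    by (simp add: of_nat_diff abs_if)
  moreover have "\<bar>mset_point w M $ i - mset_point w N $ i\<bar>
      = 2 / real w * \<bar>real (count M i) - real (count N i)\<bar>" for i
  proof -
    have "mset_point w M $ i - mset_point w N $ i = 2 / real w * (real (count M i) - real (count N i))"
      by (simp add: mset_point_def right_diff_distrib)
    then show ?thesis
      by (simp only: abs_mult) simp
  qed
  ultimately show ?thesis
    by (simp add: l1_norm_def size_eq_sum_count sum_distrib_left sum.distrib
        distrib_left)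
qed

lemma inj_mset_point: "w > 0 \<Longrightarrow> inj (mset_point w)"
  by (rule injI) (auto simp: mset_point_def vec_eq_iff multiset_eq_iff)

text \<open>
  The centre belonging to a subfamily \<open>S\<close> is the point of \<open>\<Sum>S\<close>. Different subfamilies may give the same
  centre, so the neighbours have to be shown distinct: the layer tells whether a
  member was added or removed, and the difference of the centres tells which one.
\<close>
lemma packing_from_separated_family:
  fixes G :: "'n::finite multiset set"
  assumes "w > 0" and "finite G" and size: "\<And>M. M \<in> G \<Longrightarrow> size M = w" and "w < 2 * h + 2"
    and far: "\<And>S T. S \<subseteq> G \<Longrightarrow> T \<subseteq> G \<Longrightarrow> card S = card T \<Longrightarrow> \<Sum>S \<noteq> \<Sum>T \<Longrightarrow> size (\<Sum>S - \<Sum>T) > h"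
  obtains P :: "(real^'n) set set" where "P \<noteq> {}" "translative_packing l1_unit_ball P"
    "totally_separable P" "\<And>A. A \<in> P \<Longrightarrow> card G \<le> card {B\<in>P. touches A B}"
proof -
  define c where "c S = mset_point w (\<Sum>S)" for S :: "'n multiset set"
  define Z where "Z = c ` Pow G"
  define level where "level x = nat \<lfloor>(\<Sum>i\<in>UNIV. x $ i) / 2\<rfloor>" for x :: "real^'n"
  have fin: "finite S" if "S \<subseteq> G" for S
    using that \<open>finite G\<close> by (rule finite_subset)
  have size_sum: "size (\<Sum>S) = w * card S" if "S \<subseteq> G" for S
    using fin[OF that] that by (induction S rule: finite_induct) (auto simp: size)
  have sum_c: "(\<Sum>i\<in>UNIV. c S $ i) = 2 * real (card S)" if "S \<subseteq> G" for S
    using \<open>w > 0\<close> size_sum[OF that] by (simp add: c_def sum_mset_point)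
  then have level_c: "level (c S) = card S" if "S \<subseteq> G" for S
    using that by (simp add: level_def)
  have layered: "layered Z level"
    unfolding layered_def
  proof (intro conjI ballI impI)
    fix x assume "x \<in> Z"
    then show "(\<Sum>i\<in>UNIV. x $ i) = 2 * real (level x)"
      using sum_c level_c by (auto simp: Z_def)
  next
    fix x y assume xy: "x \<in> Z" "y \<in> Z" "x \<noteq> y" "level x = level y"
    then obtain S T where ST: "S \<subseteq> G" "T \<subseteq> G" "x = c S" "y = c T"
      by (auto simp: Z_def)
    then have "card S = card T" "\<Sum>S \<noteq> \<Sum>T"
      using xy level_c by (auto simp: c_def)
    then have "size (\<Sum>S - \<Sum>T) > h" "size (\<Sum>T - \<Sum>S) > h"
      using far[of S T] far[of T S] ST by auto
    then have "real w < real (size (\<Sum>S - \<Sum>T) + size (\<Sum>T - \<Sum>S))"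
      using \<open>w < 2 * h + 2\<close> by linarith
    then show "l1_norm (x - y) > 2"
      using \<open>w > 0\<close> by (simp add: ST c_def l1_dist_mset_point field_simps)
  qed
  have "finite Z"
    using \<open>finite G\<close> by (simp add: Z_def)
  let ?P = "l1_ball ` Z"
  have degree: "card G \<le> card {B\<in>?P. touches (l1_ball x) B}" if "x \<in> Z" for x
  proof -
    obtain S where S: "S \<subseteq> G" "x = c S"
      using \<open>x \<in> Z\<close> by (auto simp: Z_def)
    \<comment> \<open>The neighbour of \<open>S\<close> in direction \<open>M\<close>, as in the graph of a cube.\<close>
    define flip where "flip M = (if M \<in> S then S - {M} else insert M S)" for M
    have sum_flip: "\<Sum>(flip M) = (if M \<in> S then \<Sum>S - M else \<Sum>S + M)" for M
      using fin[OF S(1)] by (auto simp: flip_def sum.remove)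
    have sub: "M \<subseteq># \<Sum>S" if "M \<in> S" for M
      using fin[OF S(1)] that by (simp add: sum.remove)
    have flip_sub: "flip M \<subseteq> G" if "M \<in> G" for M
      using that S by (auto simp: flip_def)
    have card_flip: "card (flip M) = (if M \<in> S then card S - 1 else card S + 1)" for M
      using fin[OF S(1)] by (auto simp: flip_def)
    have dist: "l1_norm (x - c (flip M)) = 2" if "M \<in> G" for M
    proof -
      have "size (\<Sum>S - \<Sum>(flip M)) + size (\<Sum>(flip M) - \<Sum>S) = w"
      proof (cases "M \<in> S")
        case True
        then obtain R where "\<Sum>S = M + R"
          using sub by (auto simp: mset_subset_eq_exists_conv)
        with True show ?thesis
          using that size by (simp add: sum_flip)
      qed (use that size in \<open>simp add: sum_flip\<close>)
      then show ?thesis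
        using \<open>w > 0\<close> by (simp add: S c_def l1_dist_mset_point)
    qed
    have "inj_on (\<lambda>M. c (flip M)) G"
    proof (rule inj_onI)
      fix M N assume MN: "M \<in> G" "N \<in> G" "c (flip M) = c (flip N)"
      then have eq: "\<Sum>(flip M) = \<Sum>(flip N)"
        using inj_mset_point[OF \<open>w > 0\<close>] by (auto simp: c_def dest: injD)
      have "card (flip M) = card (flip N)"
        using MN level_c flip_sub by metis
      then have "M \<in> S \<longleftrightarrow> N \<in> S"
        by (auto simp: card_flip split: if_splits)
      show "M = N"
      proof (cases "M \<in> S")
        case True
        with \<open>M \<in> S \<longleftrightarrow> N \<in> S\<close> have "\<Sum>S - M = \<Sum>S - N" "M \<subseteq># \<Sum>S" "N \<subseteq># \<Sum>S"
          using eq sub by (simp_all add: sum_flip)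
        then show ?thesis
          by (metis add_left_cancel subset_mset.diff_add)
      next
        case False
        with \<open>M \<in> S \<longleftrightarrow> N \<in> S\<close> show ?thesis
          using eq by (simp add: sum_flip)
      qed
    qed
    then have "inj_on (\<lambda>M. l1_ball (c (flip M))) G"
      by (intro inj_onI) (erule (1) inj_onD[OF _ l1_ball_inj])
    then have "card G = card ((\<lambda>M. l1_ball (c (flip M))) ` G)"
      by (rule card_image[symmetric])
    also have "\<dots> \<le> card {B\<in>?P. touches (l1_ball x) B}"
    proof (rule card_mono)
      show "finite {B\<in>?P. touches (l1_ball x) B}"
        using \<open>finite Z\<close> by simp
      show "(\<lambda>M. l1_ball (c (flip M))) ` G \<subseteq> {B\<in>?P. touches (l1_ball x) B}"
      proof (rule image_subsetI)
        fix M assume "M \<in> G"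
        then have "c (flip M) \<in> Z"
          using flip_sub by (simp add: Z_def)
        then show "l1_ball (c (flip M)) \<in> {B\<in>?P. touches (l1_ball x) B}"
          using touches_if_l1_dist_eq[OF dist[OF \<open>M \<in> G\<close>]] by blast
      qed
    qed
    finally show ?thesis .
  qed
  show thesis
  proof (rule that[of ?P])
    show "?P \<noteq> {}"
      by (auto simp: Z_def)
    show "card G \<le> card {B\<in>?P. touches A B}" if "A \<in> ?P" for A
      using that degree by blast
  qed (fact layered_imp_packing[OF layered \<open>finite Z\<close>] layered_imp_separable[OF layered])+
qed

section \<open>The packing in dimension \<open>4\<^sup>k\<close>\<close>

theorem theorem4:
  fixes d k :: nat
  assumes "k \<ge> 1" and "d = 4 ^ k" and "CARD('n::finite) = d"
  shows "\<exists>P :: (real ^ 'n) set set.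
           P \<noteq> {} \<and>
           translative_packing l1_unit_ball P \<and>
           totally_separable P \<and>
           (\<forall>A\<in>P. real (card {B\<in>P. touches A B}) \<ge> 2 powr sqrt (real d))"
proof -
  define m :: nat where "m = 2 ^ k"
  have d: "d = m ^ 2" and card_n: "CARD('n) = 2 ^ (2 * k)"
    using assms by (simp_all add: m_def power_mult flip: power_mult_distrib)
      (simp add: power2_eq_square flip: power_mult_distrib)
  have "\<exists>w h. w > 0 \<and> w < 2 * h + 2 \<and> 2 ^ m * (fact w * d ^ h) \<le> d ^ w"
  proof (cases "k \<le> 2")
    case True
    \<comment> \<open>The multisets of size 1; the packing is centred at the vertices of a cube of edge length 2.\<close>
    then have "k = 1 \<or> k = 2"
      using assms(1) by linarith
    then have "2 ^ m \<le> d"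
      by (auto simp: assms(2) m_def)
    then show ?thesis
      by (intro exI[of _ 1] exI[of _ 0]) simp
  next
    case False
    \<comment> \<open>Here \<open>w = m\<close>: the leading factor \<open>d\<^bsup>w/2\<^esup> / w!\<close> is largest near \<open>w = \<surd>d\<close>.\<close>
    have "(2::nat) ^ 3 \<le> m"
      using False unfolding m_def by (intro power_increasing) auto
    define h where "h = m div 2"
    have "even m"
      using assms(1) by (simp add: m_def)
    then have m: "m = 2 * h"
      by (simp add: h_def)
    then have "d ^ h = m ^ m"
      by (simp only: d power_mult[symmetric] m[symmetric])
    then have "2 ^ m * (fact m * d ^ h) = (2 ^ m * fact m) * m ^ m"
      by simp
    also have "\<dots> \<le> m ^ m * m ^ m"
      using two_power_fact_le_self_power[of m] \<open>2 ^ 3 \<le> m\<close> by (intro mult_right_mono) auto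
    also have "\<dots> = d ^ m"
      by (simp add: d power2_eq_square power_mult_distrib)
    finally show ?thesis
      using m \<open>2 ^ 3 \<le> m\<close> by (intro exI[of _ m] exI[of _ h]) auto
  qed
  then obtain w h where wh: "w > 0" "w < 2 * h + 2"
    and count: "2 ^ m * (fact w * d ^ h) \<le> d ^ w" by blast
  have "1 \<le> 2 * k"
    using assms(1) by simp
  then obtain G :: "'n multiset set" where size: "\<And>M. M \<in> G \<Longrightarrow> size M = w"
    and large: "CARD('n) ^ w \<le> card G * fact w * CARD('n) ^ h"
    and far: "\<And>S T. S \<subseteq> G \<Longrightarrow> T \<subseteq> G \<Longrightarrow> card S = card T \<Longrightarrow> \<Sum>S \<noteq> \<Sum>T \<Longrightarrow> size (\<Sum>S - \<Sum>T) > h"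
    using ex_large_separated_family[OF _ card_n, of w h] by blast
  have "2 ^ m * (fact w * d ^ h) \<le> card G * (fact w * d ^ h)"
    using order_trans[OF count large[unfolded assms(3)]] by (simp only: mult.assoc)
  moreover have "fact w * d ^ h > 0"
    using assms(2) by simp
  ultimately have "2 ^ m \<le> card G"
    by (simp only: mult_le_cancel2)
  have "finite G"
    using size by (intro finite_subset[OF _ finite_multisets_of_size[of w]]) auto
  obtain P :: "(real^'n) set set" where P: "P \<noteq> {}" "translative_packing l1_unit_ball P"
    "totally_separable P" and degree: "\<And>A. A \<in> P \<Longrightarrow> card G \<le> card {B\<in>P. touches A B}"
    using packing_from_separated_family[OF wh(1) \<open>finite G\<close> size wh(2) far] by blast
  have "2 powr sqrt (real d) = real (2 ^ m)"
    by (simp add: d powr_realpow)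
  then have "2 powr sqrt (real d) \<le> real (card {B\<in>P. touches A B})" if "A \<in> P" for A
    using le_trans[OF \<open>2 ^ m \<le> card G\<close> degree[OF that]] by (simp only: of_nat_le_iff)
  with P show ?thesis
    by blast
qed

end
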